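(* Suppose that $q\equiv\pm1\pmod 8$, so that $2$ is a square in $\mathbb{F}_q$. Let $s\in\{1/\sqrt2,-1/\sqrt2\}\subset\mathbb{F}_q$, so that $c=1-s^2=1/2\in\mathcal{C}$. Then each monic irreducible factor $I(y)$ of $g_s(y)$ over $\mathbb{F}_q$ has the form $$y^4-2y^3+\frac{5}{4}y^2-\frac14 y-m$$ for some $m\in\mathbb{F}_q$.
   Context: $\mathbb{F}_q$ is a finite field with $q$ elements, $q$ a power of an odd prime; $n=(q+1)/2$; for $s\in\mathbb{F}_q$, $g_s(y) := y^n+(1-y)^n-s \in \mathbb{F}_q[y]$. $\rho$ is the quadratic character on $\mathbb{F}_q$ and $\mathcal{C} := \{a \in \mathbb{F}_q : \rho(a)=\rho(1-a)=1\}$. *)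

theory Defs
  imports
    "HOL-Computational_Algebra.Computational_Algebra"
    "HOL-Library.Cardinality"
    "HOL-Number_Theory.Cong"
begin

text \<open>Finite fields are types of class \<open>{field, finite}\<close>; the order is \<open>CARD('a)\<close>.\<close>

definition quadratic_character :: "'a::{field,finite} \<Rightarrow> int" where
  "quadratic_character a =
     (if a = 0 then 0 else if (\<exists>b. b ^ 2 = a) then 1 else -1)"

definition C_set :: "'a::{field,finite} set" where
  "C_set = {a. quadratic_character a = 1 \<and> quadratic_character (1 - a) = 1}"

definition g_poly :: "'a::{field,finite} \<Rightarrow> 'a poly" where
  "g_poly s = (let n = (CARD('a) + 1) div 2; y = [:0, 1:] in y ^ n + (1 - y) ^ n - [:s:])"

end

theory Submission
  imports Defs
begin

text \<open>
  Let \<open>q\<close> be the order of the field and \<open>Y\<close> a root of \<open>g_s\<close>, where \<open>2 s\<^sup>2 = 1\<close>. Choose square roots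
  \<open>u\<close> of \<open>Y\<close> and \<open>v\<close> of \<open>1 - Y\<close>. Then \<open>(u, v)\<close> and its Frobenius image \<open>(u^q, v^q)\<close> lie on the circle
  \<open>u\<^sup>2 + v\<^sup>2 = 1\<close>, and \<open>g_s(Y) = 0\<close> says that their inner product is \<open>s\<close>, the cosine of an odd
  multiple of \<open>45\<close> degrees. So Frobenius acts on \<open>(u, v)\<close> as a rotation of order \<open>8\<close>, and on the
  doubled angle, whose cosine is \<open>2 Y - 1\<close>, as a rotation by a right angle. Hence the
  conjugates of \<open>a = 2 Y - 1\<close> are \<open>a, b, -a, -b\<close> with \<open>a\<^sup>2 + b\<^sup>2 = 1\<close>: there are exactly four of them,
  and \<open>a\<close> is a root of \<open>X^2 (1 - X^2) = e\<close> for a constant \<open>e\<close>. Substituting \<open>2 Y - 1\<close> for \<open>X\<close> gives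
  the stated quartic.

  The formal proof avoids the extension field and the square roots by working with congruences of
  polynomials in \<open>Y\<close> modulo an irreducible factor \<open>P\<close> of \<open>g_s\<close>, with \<open>b = a^q\<close>.
  Lemma \<open>conjugate_relations\<close> extracts \<open>a\<^sup>2 + b\<^sup>2 = 1\<close> and \<open>b^q = - a\<close> from the equation \<open>g_s = 0\<close>.
  Since \<open>a\<^sup>2 (1 - a\<^sup>2)\<close> is then invariant under Frobenius, it is congruent to a constant, so \<open>P\<close> divides
  the quartic (\<open>prime_factor_dvd_quartic\<close>). Conversely \<open>P\<close>, as a polynomial in \<open>a\<close>, vanishes at
  \<open>a, b, -a, -b\<close>, which are distinct modulo \<open>P\<close>, so its degree is at least \<open>4\<close>
  (\<open>degree_prime_factor_gt_3\<close>).

  That \<open>2\<close> is a square when \<open>q\<close> is \<open>1\<close> or \<open>-1\<close> modulo \<open>8\<close> is proved with an eighth root of unity: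
  \<open>z + 1/z\<close> is a square root of \<open>2\<close>, and \<open>z^q\<close> is \<open>z\<close> or \<open>1/z\<close>, so this square root is fixed by
  Frobenius.
\<close>

section \<open>Frobenius on polynomials over a finite field\<close>

text \<open>
  The classical argument: multiplication by \<open>x \<noteq> 0\<close> permutes the nonzero elements, so it leaves
  their product unchanged.
\<close>
lemma power_card_eq_same:
  fixes x :: "'a::{field,finite}"
  shows "x ^ CARD('a) = x"
proof (cases "x = 0")
  case False
  let ?U = "UNIV - {0::'a}"
  have "bij_betw ((*) x) ?U ?U"
    using False by (intro bij_betwI[of _ _ _ "\<lambda>y. y / x"]) auto
  then have "\<Prod>?U = (\<Prod>y\<in>?U. x * y)"
    by (rule prod.reindex_bij_betw[symmetric])
  also have "\<dots> = x ^ card ?U * \<Prod>?U"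
    by (simp add: prod.distrib)
  finally have "x ^ card ?U = 1"
    by simp
  then have "x ^ Suc (card ?U) = x"
    by (simp only: power_Suc mult_1_right)
  moreover have "Suc (card ?U) = CARD('a)"
    by (rule card_Suc_Diff1) auto
  ultimately show ?thesis
    by (simp only:)
qed (simp add: zero_power)

lemma CHAR_eq_if_card_prime_power:
  assumes "prime p" and "CARD('a::{field,finite}) = p ^ k"
  shows "CHAR('a) = p"
proof -
  have "CHAR('a) > 0"
    by (simp add: finite_imp_CHAR_pos)
  then have "prime CHAR('a)"
    by (rule prime_CHAR_semidom)
  moreover have "CHAR('a) dvd p ^ k"
  proof -
    have "(\<Sum>x\<in>UNIV. x + 1 :: 'a) = (\<Sum>x\<in>UNIV. x)"
      by (rule sum.reindex_bij_witness[of _ "\<lambda>x. x - 1" "\<lambda>x. x + 1"]) auto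
    then have "of_nat CARD('a) = (0::'a)"
      by (simp add: sum.distrib)
    then show ?thesis
      using assms(2) by (simp only: of_nat_eq_0_iff_char_dvd)
  qed
  ultimately show ?thesis
    using assms(1) by (meson prime_dvd_power primes_dvd_imp_eq)
qed

lemma poly_add_power_card:
  fixes x y :: "'a::{field,finite} poly"
  assumes "prime p" and "CARD('a) = p ^ k"
  shows "(x + y) ^ CARD('a) = x ^ CARD('a) + y ^ CARD('a)"
  using CHAR_eq_if_card_prime_power[OF assms] assms by (intro freshmans_dream') auto

lemma poly_diff_power_card:
  fixes x y :: "'a::{field,finite} poly"
  assumes "prime p" and "CARD('a) = p ^ k"
  shows "(x - y) ^ CARD('a) = x ^ CARD('a) - y ^ CARD('a)"
  using poly_add_power_card[OF assms, of "x - y" y] by simp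

lemma const_poly_power_card:
  fixes c :: "'a::{field,finite}"
  shows "[:c:] ^ CARD('a) = [:c:]"
  by (simp add: poly_const_pow power_card_eq_same)

lemma pcompose_power_card:
  fixes f h :: "'a::{field,finite} poly"
  assumes "prime p" and "CARD('a) = p ^ k"
  shows "pcompose f h ^ CARD('a) = pcompose f (h ^ CARD('a))"
  by (induction f)
     (simp_all add: pcompose_pCons poly_add_power_card[OF assms] const_poly_power_card
        power_mult_distrib zero_power)

text \<open>
  The identity \<open>\<Prod>e. (X - e) = X^q - X\<close> with \<open>h\<close> substituted for \<open>X\<close>. Both sides of that identity
  are monic of degree \<open>q\<close> and vanish on the whole field.
\<close>
lemma prod_diff_const_poly:
  fixes h :: "'a::{field,finite} poly"
  shows "(\<Prod>e\<in>UNIV. h - [:e:]) = h ^ CARD('a) - h"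
proof -
  let ?P = "\<Prod>e\<in>UNIV. [:- e, 1:] :: 'a poly" and ?Q = "[:0, 1:] ^ CARD('a) - [:0, 1:] :: 'a poly"
  have card: "1 < CARD('a)"
    using card_mono[of UNIV "{0, 1::'a}"] by simp
  have deg_P: "degree ?P = CARD('a)"
    by (subst degree_prod_eq_sum_degree) auto
  have deg_Q: "degree ?Q \<le> CARD('a)"
    using card by (intro degree_diff_le) (auto simp: degree_power_eq)
  have "?P = ?Q"
  proof (rule poly_eqI_degree_lead_coeff[where A = UNIV and n = "CARD('a)"])
    have "lead_coeff ?P = 1"
      by (simp add: lead_coeff_prod)
    moreover have "coeff ?Q (CARD('a)) = 1"
      using card by (auto simp: coeff_linear_power coeff_pCons split: nat.splits)
    ultimately show "coeff ?P (CARD('a)) = coeff ?Q (CARD('a))"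
      using deg_P by simp
  qed (auto simp: deg_P deg_Q poly_prod power_card_eq_same)
  then have "pcompose ?P h = pcompose ?Q h"
    by simp
  moreover have "pcompose ([:0, 1:] ^ n) h = h ^ n" for n
    by (induction n) (simp_all add: pcompose_mult pcompose_1 pcompose_pCons)
  moreover have "pcompose [:- e, 1:] h = h - [:e:]" for e
    by (simp add: pcompose_pCons)
  moreover have "pcompose [:0, 1:] h = h"
    by (simp add: pcompose_pCons)
  ultimately show ?thesis
    by (simp add: pcompose_prod pcompose_diff)
qed

text \<open>
  In the extension field of polynomials modulo \<open>P\<close>, the elements fixed by Frobenius are those of the
  base field, since they are the roots of \<open>X^q - X\<close>.
\<close>
lemma prime_dvd_diff_const_if_frobenius_fixed:
  fixes h :: "'a::{field,finite} poly"
  assumes "prime_elem P" and "P dvd h ^ CARD('a) - h"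
  obtains e where "P dvd h - [:e:]"
proof -
  have "\<exists>e\<in>A. P dvd h - [:e:]" if "P dvd (\<Prod>e\<in>A. h - [:e:])" for A
    using that prime_elem_not_unit[OF assms(1)]
    by (induction A rule: infinite_finite_induct)
       (auto simp: prime_elem_dvd_mult_iff[OF assms(1)])
  from this[of UNIV] show ?thesis
    using assms(2) that by (auto simp: prod_diff_const_poly)
qed

section \<open>Two is a square\<close>

text \<open>
  If \<open>c\<close> were not a square, the factors of \<open>t^q - t = \<Prod>e. (t - e)\<close> would all be units modulo \<open>M\<close>,
  because \<open>(t - e) * (t + e)\<close> is congruent to the constant \<open>c - e\<^sup>2\<close>. Arguing with the product
  lets \<open>M\<close> be reducible.
\<close>
lemma square_if_frobenius_fixed_root:
  fixes M t :: "'a::{field,finite} poly"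
  assumes "degree M > 0" and fixed: "M dvd t ^ CARD('a) - t" and root: "M dvd t ^ 2 - [:c:]"
  shows "\<exists>r. r ^ 2 = c"
proof -
  have "[t ^ 2 - [:e:] ^ 2 = [:c:] - [:e:] ^ 2] (mod M)" for e
    using root by (intro cong_diff) (auto simp: cong_iff_dvd_diff)
  then have "[(\<Prod>e\<in>UNIV. t ^ 2 - [:e:] ^ 2) = (\<Prod>e\<in>UNIV. [:c:] - [:e:] ^ 2)] (mod M)"
    by (intro cong_prod) auto
  then have iff: "M dvd (\<Prod>e\<in>UNIV. t ^ 2 - [:e:] ^ 2) \<longleftrightarrow> M dvd (\<Prod>e\<in>UNIV. [:c:] - [:e:] ^ 2)"
    by (rule cong_dvd_iff)
  have "(\<Prod>e\<in>UNIV. t ^ 2 - [:e:] ^ 2) = (\<Prod>e\<in>UNIV. t - [:e:]) * (\<Prod>e\<in>UNIV. t + [:e:])"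
    by (subst prod.distrib[symmetric], intro prod.cong refl)
       (simp only: power2_eq_square square_diff_square_factored mult.commute)
  moreover have "M dvd (\<Prod>e\<in>UNIV. t - [:e:])"
    using fixed by (simp add: prod_diff_const_poly)
  ultimately have "M dvd (\<Prod>e\<in>UNIV. [:c:] - [:e:] ^ 2)"
    unfolding iff[symmetric] by simp
  moreover have "(\<Prod>e\<in>UNIV. [:c:] - [:e:] ^ 2) = [:\<Prod>e\<in>UNIV. c - e ^ 2:]"
    by (simp add: poly_const_pow prod_to_poly)
  ultimately have "M dvd [:\<Prod>e\<in>UNIV. c - e ^ 2:]"
    by simp
  then have "(\<Prod>e\<in>UNIV. c - e ^ 2) = 0"
    using assms(1) dvd_imp_degree_le[of M "[:\<Prod>e\<in>UNIV. c - e ^ 2:]"]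
    by (cases "(\<Prod>e\<in>UNIV. c - e ^ 2) = 0") auto
  then show ?thesis
    by auto
qed

lemma two_is_square:
  assumes p: "prime p" "CARD('a::{field,finite}) = p ^ k"
    and q8: "[int CARD('a) = 1] (mod 8) \<or> [int CARD('a) = - 1] (mod 8)"
  shows "\<exists>r::'a. r ^ 2 = 2"
proof -
  let ?q = "CARD('a)"
  define Y :: "'a poly" where "Y = [:0, 1:]"
  \<comment> \<open>Modulo \<open>M\<close>, the class of \<open>Y\<close> is a primitive eighth root of unity with inverse \<open>- Y ^ 3\<close>.\<close>
  define M where "M = Y ^ 4 + 1"
  have Y8: "[Y ^ (8 * j) = 1] (mod M)" for j
  proof -
    have "Y ^ 8 - 1 = M * (Y ^ 4 - 1)"
      unfolding M_def by algebra
    then have "[Y ^ 8 = 1] (mod M)"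
      by (simp add: cong_iff_dvd_diff)
    from cong_pow[OF this, of j] show ?thesis
      by (simp add: power_mult)
  qed
  have frob: "(Y - Y ^ 3) ^ ?q = Y ^ ?q - (Y ^ ?q) ^ 3"
    by (simp add: poly_diff_power_card[OF p] power_commutes flip: power_mult) (simp add: mult.commute)
  have "[int ?q = 1] (mod 8) \<or> [int ?q = 7] (mod 8)"
    using q8 by (auto simp: cong_def)
  then have "?q mod 8 = 1 \<or> ?q mod 8 = 7"
    by (simp add: cong_def) presburger
  then have "[(Y - Y ^ 3) ^ ?q = Y - Y ^ 3] (mod M)"
  proof
    assume "?q mod 8 = 1"
    then have "?q = 8 * (?q div 8) + 1"
      by presburger
    then have "[Y ^ ?q = 1 * Y] (mod M)"
      using Y8 by (metis cong_scalar_right power_add power_one_right)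
    then show ?thesis
      unfolding frob by (intro cong_diff cong_pow) auto
  next
    assume "?q mod 8 = 7"
    then have "?q = 8 * (?q div 8) + 7"
      by presburger
    then have Yq: "[Y ^ ?q = 1 * Y ^ 7] (mod M)"
      using Y8 by (metis cong_scalar_right power_add)
    then have "[Y ^ ?q - (Y ^ ?q) ^ 3 = Y ^ 7 - (Y ^ 7) ^ 3] (mod M)"
      by (intro cong_diff cong_pow) auto
    moreover have "Y ^ 7 - (Y ^ 7) ^ 3 - (Y - Y ^ 3) =
        M * (Y ^ 13 - Y ^ 17 - Y ^ 9 + Y ^ 5 + Y ^ 3 - Y)"
      unfolding M_def by algebra
    then have "[Y ^ 7 - (Y ^ 7) ^ 3 = Y - Y ^ 3] (mod M)"
      unfolding cong_iff_dvd_diff by (metis dvd_triv_left)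
    ultimately show ?thesis
      unfolding frob by (rule cong_trans)
  qed
  moreover have "M dvd (Y - Y ^ 3) ^ 2 - [:2:]"
  proof
    have "(Y - Y ^ 3) ^ 2 - 2 = M * (Y ^ 2 - 2)"
      unfolding M_def by algebra
    then show "(Y - Y ^ 3) ^ 2 - [:2:] = M * (Y ^ 2 - 2)"
      by (simp add: numeral_poly)
  qed
  moreover have "degree M > 0"
    by (simp add: M_def Y_def numeral_eq_Suc one_pCons)
  ultimately show ?thesis
    using square_if_frobenius_fixed_root by (metis cong_iff_dvd_diff)
qed

section \<open>The conjugates of a root\<close>

text \<open>
  The rotation in coordinates that need no square roots. With \<open>A = Y^n\<close> and \<open>B = (1 - Y)^n\<close>, which
  stand for \<open>u u^q\<close> and \<open>v v^q\<close>, both \<open>A\<^sup>2\<close> and \<open>B\<^sup>2\<close> are polynomials in \<open>a\<close> and \<open>b\<close>. So \<open>A + B = s\<close>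
  gives \<open>4 A B = - a b\<close>, and squaring this gives \<open>a\<^sup>2 + b\<^sup>2 = 1\<close>. The latter leaves the sign in
  \<open>b^q = \<plusminus> a\<close> open. The sign comes from the \<open>n\<close>-th power of \<open>b\<^sup>2 = 1 - a\<^sup>2 = 4 Y (1 - Y)\<close>, which is
  \<open>b b^q = 4 A B\<close>, to be compared with \<open>4 A B = - a b\<close>.
\<close>
lemma conjugate_relations:
  fixes s :: "'a::{field,finite}"
  assumes p: "prime p" "CARD('a) = p ^ k" and "odd CARD('a)"
    and s: "2 * s ^ 2 = 1" and dvd: "P dvd g_poly s"
  defines "a \<equiv> [:- 1, 2:]"
  defines "b \<equiv> a ^ CARD('a)"
  shows "P dvd a ^ 2 + b ^ 2 - 1" and "P dvd b * (b ^ CARD('a) + a)"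
proof -
  let ?q = "CARD('a)"
  define n where "n = (?q + 1) div 2"
  have n: "2 * n = ?q + 1"
    using \<open>odd ?q\<close> by (simp add: n_def)
  define Y :: "'a poly" where "Y = [:0, 1:]"
  define Z where "Z = Y ^ ?q"
  define A B S where "A = Y ^ n" and "B = (1 - Y) ^ n" and "S = [:s:]"
  have D: "P dvd A + B - S"
    using dvd by (simp add: g_poly_def Let_def n_def A_def B_def S_def Y_def)
  have two_q: "(2 :: 'a poly) ^ ?q = 2"
    using const_poly_power_card[of "2::'a"] by (simp add: numeral_poly)
  have a: "a = 2 * Y - 1"
    by (simp add: a_def Y_def numeral_poly one_pCons)
  have b: "b = 2 * Z - 1"
    by (simp add: Z_def b_def a poly_diff_power_card[OF p] power_mult_distrib two_q)
  have AA: "A ^ 2 = Y * Z"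
    by (simp add: A_def Z_def mult.commute[of n] n flip: power_mult)
  have "B ^ 2 = (1 - Y) * (1 - Y) ^ ?q"
    by (simp add: B_def mult.commute[of n] n flip: power_mult)
  then have BB: "B ^ 2 = (1 - Y) * (1 - Z)"
    by (simp add: Z_def poly_diff_power_card[OF p])
  have SS: "2 * S ^ 2 = 1"
    using s by (simp add: S_def poly_const_pow numeral_poly one_pCons mult.commute)
  \<comment> \<open>The difference of squares appears because \<open>2 A\<^sup>2 + 2 B\<^sup>2 = a b + 1\<close> and \<open>2 S\<^sup>2 = 1\<close>.\<close>
  have "4 * A * B + a * b = (A + B - S) * (2 * (A + B + S))"
    using AA BB SS a b by algebra
  then have 1: "P dvd 4 * A * B + a * b"
    using D by (simp only: dvd_mult2)
  have "a ^ 2 + b ^ 2 - 1 = (4 * A * B + a * b) * (a * b - 4 * A * B)"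
    using AA BB a b by algebra
  then show 2: "P dvd a ^ 2 + b ^ 2 - 1"
    using 1 by simp
  have "(1 - a ^ 2) ^ n = (2 ^ 2 * (Y * (1 - Y))) ^ n"
    by (rule arg_cong[where f = "\<lambda>x. x ^ n"]) (use a in algebra)
  also have "\<dots> = 2 ^ (2 * n) * (A * B)"
    by (simp only: power_mult_distrib power_mult A_def B_def)
  \<comment> \<open>Here \<open>2 ^ (2 * n) = 2 * 2^q = 4\<close>.\<close>
  also have "\<dots> = 4 * A * B"
    by (simp add: n two_q)
  finally have "(1 - a ^ 2) ^ n = 4 * A * B" .
  moreover have "(b ^ 2) ^ n = b * b ^ ?q"
    by (simp add: n flip: power_mult)
  moreover have "[b ^ 2 = 1 - a ^ 2] (mod P)"
    using 2 by (simp add: cong_iff_dvd_diff algebra_simps)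
  then have "[(b ^ 2) ^ n = (1 - a ^ 2) ^ n] (mod P)"
    by (rule cong_pow)
  ultimately have "P dvd b * b ^ ?q - 4 * A * B"
    by (simp add: cong_iff_dvd_diff)
  from dvd_add[OF this 1] show "P dvd b * (b ^ ?q + a)"
    by (simp add: algebra_simps)
qed

text \<open>
  The conjugates \<open>a, b, -a, -b\<close> are distinct modulo \<open>P\<close>: if \<open>b = \<plusminus> a\<close>, then applying Frobenius
  twice would fix \<open>a\<close>, whereas it sends \<open>a\<close> to \<open>- a\<close>.
\<close>
lemma prime_factor_relations:
  fixes s :: "'a::{field,finite}"
  assumes p: "prime p" "CARD('a) = p ^ k" and odd: "odd CARD('a)"
    and s: "2 * s ^ 2 = 1" and P: "prime_elem P" and dvd: "P dvd g_poly s"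
  defines "a \<equiv> [:- 1, 2:]"
  defines "b \<equiv> a ^ CARD('a)"
  shows "\<not> P dvd a" and "\<not> P dvd b" and "\<not> P dvd a ^ 2 - b ^ 2"
    and "P dvd b ^ CARD('a) + a"
proof -
  let ?q = "CARD('a)"
  note rel = conjugate_relations[OF p odd s dvd, folded a_def, folded b_def]
  have unit: "\<not> P dvd 1"
    using P by (simp add: prime_elem_def)
  show na: "\<not> P dvd a"
  proof
    assume "P dvd a"
    moreover from this have "P dvd b"
      unfolding b_def by (rule dvd_trans) simp
    ultimately have "P dvd a ^ 2 + b ^ 2"
      by (simp add: power2_eq_square)
    from dvd_diff[OF this rel(1)] show False
      using unit by simp
  qed
  then show nb: "\<not> P dvd b"
    using P prime_elem_dvd_power unfolding b_def by blast
  show c: "P dvd b ^ ?q + a"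
    using rel(2) nb P by (simp add: prime_elem_dvd_mult_iff)
  have two: "(2::'a) \<noteq> 0"
    using s by auto
  show "\<not> P dvd a ^ 2 - b ^ 2"
  proof
    assume "P dvd a ^ 2 - b ^ 2"
    moreover have "a ^ 2 - b ^ 2 = - ((b - a) * (b + a))"
      by algebra
    ultimately have "P dvd (b - a) * (b + a)"
      by (simp only: dvd_minus_iff)
    then have "P dvd b - a \<or> P dvd b + a"
      using P by (simp add: prime_elem_dvd_mult_iff)
    then have "P dvd b ^ ?q - a"
    proof
      assume *: "P dvd b - a"
      then have "P dvd (b - a) ^ ?q"
        by (rule dvd_trans) simp
      then have "P dvd b ^ ?q - b"
        by (simp only: poly_diff_power_card[OF p] flip: b_def)
      from dvd_add[OF this *] show ?thesis by simp
    next
      assume *: "P dvd b + a"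
      then have "P dvd (b + a) ^ ?q"
        by (rule dvd_trans) simp
      then have "P dvd b ^ ?q + b"
        by (simp only: poly_add_power_card[OF p] flip: b_def)
      from dvd_diff[OF this *] show ?thesis by simp
    qed
    from dvd_diff[OF c this] have "P dvd smult 2 a"
      by (simp add: numeral_poly)
    with na two show False
      using dvd_smult_cancel by blast
  qed
qed

section \<open>Irreducible factors are quartic\<close>

lemma poly_eq_coeffs_if_degree_le_3:
  assumes "degree f \<le> 3"
  shows "f = [:coeff f 0, coeff f 1, coeff f 2, coeff f 3:]"
proof (rule poly_eqI)
  fix i
  show "coeff f i = coeff [:coeff f 0, coeff f 1, coeff f 2, coeff f 3:] i"
    using assms by (auto simp: coeff_pCons numeral_eq_Suc coeff_eq_0 split: nat.splits)
qed

text \<open>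
  The case of four roots symmetric about \<open>0\<close> of the fact that a nonzero polynomial over a field has
  no more roots than its degree, here for roots in the field of polynomials modulo \<open>P\<close>. By symmetry,
  the even and odd parts of \<open>f\<close> vanish separately; if the degree were at most \<open>3\<close>, each would be
  linear in the square of the argument and have the two roots \<open>a\<^sup>2\<close> and \<open>b\<^sup>2\<close>.
\<close>
lemma degree_gt_3_if_four_roots:
  fixes f :: "'a::field poly"
  assumes P: "prime_elem P" and two: "(2::'a) \<noteq> 0" and "f \<noteq> 0"
    and roots: "P dvd pcompose f a" "P dvd pcompose f (- a)"
       "P dvd pcompose f b" "P dvd pcompose f (- b)"
    and distinct: "\<not> P dvd a" "\<not> P dvd b" "\<not> P dvd a ^ 2 - b ^ 2"
  shows "degree f > 3"
proof (rule ccontr)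
  assume "\<not> degree f > 3"
  define i0 i1 i2 i3
    where "i0 = coeff f 0" and "i1 = coeff f 1" and "i2 = coeff f 2" and "i3 = coeff f 3"
  have f: "f = [:i0, i1, i2, i3:]"
    unfolding i0_def i1_def i2_def i3_def using \<open>\<not> degree f > 3\<close> by (intro poly_eq_coeffs_if_degree_le_3) simp
  have const: "c = 0" if "P dvd [:c:]" for c
  proof (rule ccontr)
    assume "c \<noteq> 0"
    then have "is_unit [:c:]" by (simp add: is_unit_const_poly_iff dvd_field_iff)
    with that have "is_unit P" by (rule dvd_unit_imp_unit)
    with P show False by (simp add: prime_elem_def)
  qed
  have parts: "P dvd [:i0:] + [:i2:] * x ^ 2 \<and> P dvd [:i1:] + [:i3:] * x ^ 2"
    if "P dvd pcompose f x" "P dvd pcompose f (- x)" "\<not> P dvd x" for x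
  proof -
    have f_eq: "pcompose f y = [:i0:] + y * ([:i1:] + y * ([:i2:] + y * [:i3:]))" for y
      unfolding f by (simp add: pcompose_pCons)
    have "pcompose f x + pcompose f (- x) = 2 * ([:i0:] + [:i2:] * x ^ 2)"
      unfolding f_eq by algebra
    then have "pcompose f x + pcompose f (- x) = smult 2 ([:i0:] + [:i2:] * x ^ 2)"
      by (simp add: numeral_poly)
    then have 1: "P dvd [:i0:] + [:i2:] * x ^ 2"
      using dvd_add[OF that(1,2)] two by (metis dvd_smult_cancel)
    have "pcompose f x - pcompose f (- x) = 2 * (x * ([:i1:] + [:i3:] * x ^ 2))"
      unfolding f_eq by algebra
    then have "pcompose f x - pcompose f (- x) = smult 2 (x * ([:i1:] + [:i3:] * x ^ 2))"
      by (simp add: numeral_poly)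
    then have "P dvd x * ([:i1:] + [:i3:] * x ^ 2)"
      using dvd_diff[OF that(1,2)] two by (metis dvd_smult_cancel)
    then show ?thesis
      using 1 P that(3) by (simp add: prime_elem_dvd_mult_iff)
  qed
  have zero: "u = 0 \<and> v = 0" if "P dvd [:u:] + [:v:] * a ^ 2" "P dvd [:u:] + [:v:] * b ^ 2" for u v
  proof -
    have "P dvd [:v:] * (a ^ 2 - b ^ 2)"
      using dvd_diff[OF that] by (simp add: algebra_simps)
    then have "v = 0"
      using distinct(3) dvd_smult_cancel[of P v "a ^ 2 - b ^ 2"] by auto
    then show ?thesis
      using that(1) const by simp
  qed
  have "f = 0"
    using zero parts[OF roots(1,2) distinct(1)] parts[OF roots(3,4) distinct(2)] f by auto
  with \<open>f \<noteq> 0\<close> show False ..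
qed

lemma cong_pcompose:
  fixes f x y :: "'a::field poly"
  assumes "[x = y] (mod P)"
  shows "[pcompose f x = pcompose f y] (mod P)"
  by (induction f) (auto simp: pcompose_pCons intro!: cong_add cong_mult assms)

lemma degree_prime_factor_gt_3:
  fixes s :: "'a::{field,finite}"
  assumes p: "prime p" "CARD('a) = p ^ k" and odd: "odd CARD('a)"
    and s: "2 * s ^ 2 = 1" and P: "prime_elem P" and dvd: "P dvd g_poly s"
  shows "degree P > 3"
proof -
  let ?q = "CARD('a)"
  define a :: "'a poly" where "a = [:- 1, 2:]"
  define b where "b = a ^ ?q"
  note rel = prime_factor_relations[OF p odd s P dvd, folded a_def, folded b_def]
  have two: "(2::'a) \<noteq> 0"
    using s by auto
  \<comment> \<open>\<open>f\<close> is \<open>P\<close> written as a polynomial in \<open>a\<close>.\<close>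
  define f where "f = pcompose P [:1 / 2, 1 / 2:]"
  have "pcompose [:1 / 2, 1 / 2:] a = [:0, 1:]"
    using two by (simp add: a_def pcompose_pCons)
  then have fa: "pcompose f a = P"
    by (simp add: f_def flip: pcompose_assoc)
  have frob: "P dvd pcompose f (x ^ ?q)" if "P dvd pcompose f x" for x
    using that by (simp flip: pcompose_power_card[OF p]) (rule dvd_trans, assumption, simp)
  have fb: "P dvd pcompose f b"
    unfolding b_def by (rule frob) (simp add: fa)
  have "[b ^ ?q = - a] (mod P)"
    using rel(4) by (simp add: cong_iff_dvd_diff)
  then have fma: "P dvd pcompose f (- a)"
    using frob[OF fb] cong_dvd_iff cong_pcompose by metis
  have fmb: "P dvd pcompose f (- b)"
    using frob[OF fma] odd by (simp add: b_def)
  have "f \<noteq> 0"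
    using fa P by auto
  have "degree f > 3"
    by (rule degree_gt_3_if_four_roots[OF P two \<open>f \<noteq> 0\<close> _ fma fb fmb rel(1,2,3)]) (simp add: fa)
  then show ?thesis
    using two by (simp add: f_def degree_pcompose)
qed

text \<open>
  Frobenius sends \<open>a\<^sup>2 (1 - a\<^sup>2)\<close> to \<open>b\<^sup>2 (1 - b\<^sup>2)\<close>, and \<open>b\<^sup>2 = 1 - a\<^sup>2\<close> exchanges its two factors.
\<close>
lemma prime_factor_dvd_quartic:
  fixes s :: "'a::{field,finite}"
  assumes p: "prime p" "CARD('a) = p ^ k" and odd: "odd CARD('a)"
    and s: "2 * s ^ 2 = 1" and P: "prime_elem P" and dvd: "P dvd g_poly s"
  obtains m where "P dvd [:- m, - (1 / 4), 5 / 4, - 2, 1:]"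
proof -
  let ?q = "CARD('a)"
  define a :: "'a poly" where "a = [:- 1, 2:]"
  define b where "b = a ^ ?q"
  define h where "h = a ^ 2 * (1 - a ^ 2)"
  have rel: "P dvd a ^ 2 + b ^ 2 - 1"
    using conjugate_relations(1)[OF p odd s dvd, folded a_def, folded b_def] .
  have "h ^ ?q = b ^ 2 * (1 - b ^ 2)"
  proof -
    have "(a ^ 2) ^ ?q = b ^ 2"
      unfolding b_def by (simp only: mult.commute flip: power_mult)
    then show ?thesis
      by (simp only: h_def power_mult_distrib poly_diff_power_card[OF p] power_one)
  qed
  moreover have "b ^ 2 * (1 - b ^ 2) - h = (a ^ 2 + b ^ 2 - 1) * (a ^ 2 - b ^ 2)"
    unfolding h_def by algebra
  ultimately have "h ^ ?q - h = (a ^ 2 + b ^ 2 - 1) * (a ^ 2 - b ^ 2)"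
    by simp
  then have "P dvd h ^ ?q - h"
    using rel by simp
  from prime_dvd_diff_const_if_frobenius_fixed[OF P this] obtain e where e: "P dvd h - [:e:]" .
  have two: "(2::'a) \<noteq> 0"
    using s by auto
  have "(16::'a) = 2 ^ 4" "(4::'a) = 2 ^ 2"
    by simp_all
  with two have nz: "(16::'a) \<noteq> 0" "(4::'a) \<noteq> 0"
    by (metis power_not_zero)+
  \<comment> \<open>Expanding \<open>h\<close> in \<open>Y\<close> gives the leading coefficient \<open>- 16\<close>; so the constant \<open>m\<close> is \<open>- e / 16\<close>.\<close>
  have "h - [:e:] = [:- 16:] * [:- (- e / 16), - (1 / 4), 5 / 4, - 2, 1:]"
    using nz by (simp add: h_def a_def power2_eq_square one_pCons field_simps)
  moreover have "is_unit [:- 16 :: 'a:]"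
    using nz by (simp add: is_unit_const_poly_iff dvd_field_iff)
  ultimately have "P dvd [:- (- e / 16), - (1 / 4), 5 / 4, - 2, 1:]"
    using e by (metis dvd_mult_unit_iff')
  then show ?thesis
    by (rule that)
qed

lemma monic_eq_if_dvd:
  fixes f g :: "'a::field poly"
  assumes "f dvd g" and "lead_coeff f = 1" and "lead_coeff g = 1" and "degree g \<le> degree f"
  shows "f = g"
proof -
  obtain h where h: "g = f * h"
    using assms(1) by blast
  with assms have "f \<noteq> 0" "h \<noteq> 0"
    by auto
  then have "degree h = 0"
    using assms(4) by (simp add: h degree_mult_eq)
  then obtain c where c: "h = [:c:]"
    by (rule degree_eq_zeroE)
  have "lead_coeff h = 1"
    using assms(2,3) by (simp add: h lead_coeff_mult)
  with h c show ?thesis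
    by simp
qed

theorem corollary4p7:
  fixes p k q :: nat
  assumes "prime p" and "odd p" and "k > 0" and "q = p ^ k"
    and "CARD('a::{field,finite}) = q"
    and "[int q = 1] (mod 8) \<or> [int q = -1] (mod 8)"
  shows "(\<exists>r::'a. r ^ 2 = 2) \<and>
    (\<forall>r s :: 'a. r ^ 2 = 2 \<longrightarrow> s \<in> {1 / r, - (1 / r)} \<longrightarrow>
       1 - s ^ 2 = 1 / 2 \<and> 1 - s ^ 2 \<in> C_set \<and>
       (\<forall>I :: 'a poly. lead_coeff I = 1 \<longrightarrow> irreducible I \<longrightarrow> I dvd g_poly s \<longrightarrow>
          (\<exists>m. I = [:- m, - (1 / 4), 5 / 4, - 2, 1:])))"
proof (intro conjI allI impI)
  have card: "CARD('a) = p ^ k"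
    using assms by simp
  have odd: "odd CARD('a)"
    using card assms(2) by simp
  show "\<exists>r::'a. r ^ 2 = 2"
    using two_is_square[OF assms(1) card] assms(5,6) by simp
  have two: "(2::'a) \<noteq> 0"
  proof
    assume "(2::'a) = 0"
    then have "of_nat 2 = (0::'a)"
      by simp
    then have "p dvd 2"
      using CHAR_eq_if_card_prime_power[OF assms(1) card] by (simp only: of_nat_eq_0_iff_char_dvd)
    with assms(1,2) show False
      using primes_dvd_imp_eq two_is_prime_nat by blast
  qed
  fix r s :: 'a
  assume r: "r ^ 2 = 2" and "s \<in> {1 / r, - (1 / r)}"
  then have ss: "s ^ 2 = 1 / 2"
    by (auto simp: power_divide)
  then show half: "1 - s ^ 2 = 1 / 2"
    using two by (simp add: field_simps)
  have "quadratic_character (1 / 2 :: 'a) = 1"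
    using two ss by (auto simp: quadratic_character_def)
  moreover have "1 - 1 / 2 = (1 / 2 :: 'a)"
    using two by (simp add: field_simps)
  ultimately show "1 - s ^ 2 \<in> C_set"
    unfolding half C_set_def mem_Collect_eq by (simp only: simp_thms)
  have s: "2 * s ^ 2 = 1"
    using ss two by (simp add: mult.commute)
  fix I :: "'a poly"
  assume monic: "lead_coeff I = 1" and "irreducible I" and dvd: "I dvd g_poly s"
  then have I: "prime_elem I"
    by (simp add: field_poly_irreducible_imp_prime)
  obtain m where "I dvd [:- m, - (1 / 4), 5 / 4, - 2, 1:]"
    using prime_factor_dvd_quartic[OF assms(1) card odd s I dvd] .
  moreover have "degree I > 3"
    using degree_prime_factor_gt_3[OF assms(1) card odd s I dvd] .
  ultimately show "\<exists>m. I = [:- m, - (1 / 4), 5 / 4, - 2, 1:]"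
    using monic by (intro exI[of _ m] monic_eq_if_dvd) auto
qed

end
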